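(* Let $c,d$ be relatively prime integers with $0\le c\le d$ and $d>0$, and let $\mathbb P$ be the one-move rider with move set $\mathbf M=\{(c,d)\}$. For $q\ge2$ write $u_{\mathbb P}(q;n)=\sum_{i=0}^{2q}\gamma_i(n)\,n^{2q-i}$. Then the period of $\gamma_3$ in $u_{\mathbb P}(q;n)$ is exactly $d$. The periodic part of $\gamma_3$ is $$-\frac{1}{(q-2)!}\,\frac{\bar n(d-\bar n)(d-c)}{2d^2},\qquad\text{where }\bar n:=(n\bmod d)\in\{0,1,\dots,d-1\}.$$
   Context: The $n\times n$ board is $[n]^2=\{1,\dots,n\}^2$. Two pieces at positions $z,z'\in[n]^2$ attack each other if $z'-z$ is an integer multiple (possibly zero) of $(c,d)$. $u_{\mathbb P}(q;n)$ is the number of placements of $q$ unlabelled copies of $\mathbb P$ on $[n]^2$ with no two attacking; for fixed $q$ it is a quasipolynomial in $n$ of degree $2q$, so each coefficient $\gamma_i$ is a periodic function of $n$. Period means smallest period. The "periodic part" of a coefficient is the part depending on $\bar n$, which vanishes when $\bar n=0$; i.e. $\gamma_3(n)$ equals a quantity independent of $n$ plus the periodic part. *)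

theory Defs
  imports Complex_Main
begin

definition board :: "nat \<Rightarrow> (int \<times> int) set" where
  "board n = {1..int n} \<times> {1..int n}"

text \<open>A rider with move set \<open>M\<close> attacks along every integer multiple of every move. The multiple
  may be zero, so two pieces on the same square attack each other.\<close>

definition attacks :: "(int \<times> int) set \<Rightarrow> int \<times> int \<Rightarrow> int \<times> int \<Rightarrow> bool" where
  "attacks M z z' \<longleftrightarrow>
     (\<exists>m\<in>M. \<exists>k::int. fst z' - fst z = k * fst m \<and> snd z' - snd z = k * snd m)"

text \<open>Since pieces on a common square attack each other (for \<open>M \<noteq> {}\<close>), a nonattacking placement
  of \<open>q\<close> unlabelled pieces is the same as its set of \<open>q\<close> occupied squares.\<close>

definition nonattacking_placements :: "(int \<times> int) set \<Rightarrow> nat \<Rightarrow> nat \<Rightarrow> (int \<times> int) set set" where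
  "nonattacking_placements M q n =
     {S. S \<subseteq> board n \<and> card S = q \<and> (\<forall>z\<in>S. \<forall>z'\<in>S. z \<noteq> z' \<longrightarrow> \<not> attacks M z z')}"

definition num_placements :: "(int \<times> int) set \<Rightarrow> nat \<Rightarrow> nat \<Rightarrow> nat" where
  "num_placements M q n = card (nonattacking_placements M q n)"

definition is_period :: "(nat \<Rightarrow> 'a) \<Rightarrow> nat \<Rightarrow> bool" where
  "is_period f p \<longleftrightarrow> p > 0 \<and> (\<forall>n. f (n + p) = f n)"

definition smallest_period :: "(nat \<Rightarrow> 'a) \<Rightarrow> nat \<Rightarrow> bool" where
  "smallest_period f p \<longleftrightarrow> is_period f p \<and> (\<forall>p'. is_period f p' \<longrightarrow> p \<le> p')"

text \<open>\<open>\<gamma> i\<close> is the coefficient of \<open>n ^ (D - i)\<close>, counting from the top degree \<open>D\<close>. The counting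
  function only has to agree with the quasipolynomial for \<open>n \<ge> 1\<close>; periodicity then still determines
  \<open>\<gamma> i\<close> everywhere, for all \<open>i \<le> D\<close>.\<close>

definition quasipoly_expansion :: "(nat \<Rightarrow> real) \<Rightarrow> nat \<Rightarrow> (nat \<Rightarrow> nat \<Rightarrow> real) \<Rightarrow> bool" where
  "quasipoly_expansion f D \<gamma> \<longleftrightarrow>
     (\<forall>i\<le>D. \<exists>p. is_period (\<gamma> i) p) \<and>
     (\<forall>n\<ge>1. f n = (\<Sum>i=0..D. \<gamma> i n * real n ^ (D - i)))"

end

theory Submission imports Defs "HOL-Computational_Algebra.Polynomial" begin

text \<open>
The squares on a line of direction \<open>(c, d)\<close> are the squares of the board with a common value of
\<open>d x - c y\<close>, and a nonattacking placement takes at most one square from each line. So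
\<open>u(q; n)\<close> is the \<open>q\<close>-th elementary symmetric polynomial \<open>e(q)\<close> of the line sizes, and Newton's
identity \<open>q e(q) = e(q-1) p(1) - e(q-2) p(2) + e(q-3) p(3) - \<dots>\<close>
(\<open>newton_identity_partial_transversals\<close>) reduces everything to the sums \<open>p(k)\<close> of the \<open>k\<close>-th powers
of the line sizes, of which \<open>p(1) = n\<^sup>2\<close> is the number of squares.

For \<open>j d \<le> n\<close> there are \<open>(n - j c) (n - j d)\<close> squares \<open>z\<close> such that \<open>z\<close> and \<open>z + j (c, d)\<close> both lie on
the board, and a line of size \<open>s \<ge> j\<close> contributes \<open>s - j\<close> of them. Writing \<open>s\<^sup>k\<close> in terms of the
numbers \<open>s - j\<close> gives \<open>p(k) = n\<^sup>2 + \<Sum>\<^sub>j w(j) (n - j c) (n - j d)\<close>, summed over \<open>1 \<le> j \<le> N\<close> with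
\<open>N = n div d\<close>, where \<open>w\<close> is the second difference of \<open>j\<^sup>k\<close>, for \<open>k \<ge> 2\<close> a polynomial of degree
\<open>k - 2\<close>. On the residue class \<open>n mod d = r\<close> one has \<open>N = n / d - t\<close> with \<open>t = r / d\<close>, so there
\<open>p(k)\<close> is a polynomial in \<open>n\<close> of degree at most \<open>k + 1\<close>.

The point is that for \<open>k \<ge> 2\<close> this polynomial depends only weakly on \<open>r\<close>
(\<open>ex_rectangle_sum_poly\<close>). Replacing \<open>t\<close> by \<open>t + 1\<close> drops the last summand, and in it the factor
\<open>n - N d = d t\<close> does not grow with \<open>n\<close>; hence only coefficients of degree at most \<open>k - 1\<close> change.
Since every coefficient is a polynomial in \<open>t\<close>, those of degree \<open>k\<close> and \<open>k + 1\<close> do not depend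
on \<open>r\<close> at all. For \<open>k = 2\<close> the same difference equation, solved exactly, shows that the coefficient
of \<open>n\<close> varies with \<open>r\<close> as \<open>2 h(r)\<close>, where \<open>h(r) = r (d - r) (d - c) / (2 d\<^sup>2)\<close>.

The term \<open>e(q-k) p(k)\<close> of Newton's identity has degree \<open>2 q - (k - 1)\<close>. By induction on \<open>q\<close> the
residue \<open>r\<close> therefore affects no coefficient of degree above \<open>2 q - 3\<close>, and the one of degree
\<open>2 q - 3\<close> only through \<open>e(q-1) p(1)\<close> and through the linear coefficient of \<open>p(2)\<close> in
\<open>e(q-2) p(2)\<close>. The two contributions to \<open>q e(q)\<close> are \<open>- h(r) / (q - 3)!\<close>, absent for \<open>q = 2\<close>, and
\<open>- 2 h(r) / (q - 2)!\<close>, with sum \<open>- q h(r) / (q - 2)!\<close> (\<open>ex_placement_polys\<close>). Finally, for \<open>c < d\<close> the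
function \<open>h\<close> vanishes on \<open>{0..<d}\<close> only at \<open>0\<close>, so no period is shorter than \<open>d\<close>; and \<open>c = d\<close>
forces \<open>d = 1\<close> by coprimality.
\<close>

section \<open>Partial transversals and Newton's identity\<close>

text \<open>The fibres of \<open>f\<close> will be the lines of the board.\<close>

definition partial_transversals :: "('a \<Rightarrow> 'b) \<Rightarrow> 'a set \<Rightarrow> nat \<Rightarrow> 'a set set" where
  "partial_transversals f B q = {S. S \<subseteq> B \<and> card S = q \<and> inj_on f S}"

lemma finite_partial_transversals: "finite B \<Longrightarrow> finite (partial_transversals f B q)"
  by (rule finite_subset[of _ "Pow B"]) (auto simp: partial_transversals_def)

lemma partial_transversals_0: "finite B \<Longrightarrow> partial_transversals f B 0 = {{}}"
  by (auto simp: partial_transversals_def dest: finite_subset)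

text \<open>The recursion \<open>e(q + 1; X, x) = e(q + 1; X) + x e(q; X)\<close> of elementary symmetric polynomials: a
  partial transversal either avoids the new fibre \<open>F\<close> or takes exactly one of its points.\<close>

lemma card_partial_transversals_add_fibre:
  assumes fin: "finite B" "finite F"
    and F: "\<And>z. z \<in> F \<Longrightarrow> f z = l" and B: "\<And>z. z \<in> B \<Longrightarrow> f z \<noteq> l"
  shows "card (partial_transversals f (B \<union> F) (Suc q)) =
    card (partial_transversals f B (Suc q)) + card F * card (partial_transversals f B q)"
proof -
  let ?T = "partial_transversals f"
  let ?ins = "\<lambda>(z, S). insert z S"
  have disj: "B \<inter> F = {}" using F B by blast
  have split: "?T (B \<union> F) (Suc q) = ?T B (Suc q) \<union> ?ins ` (F \<times> ?T B q)"
  proof (intro set_eqI iffI)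
    fix S assume S: "S \<in> ?T (B \<union> F) (Suc q)"
    then have sub: "S \<subseteq> B \<union> F" and card: "card S = Suc q" and inj: "inj_on f S"
      by (auto simp: partial_transversals_def)
    show "S \<in> ?T B (Suc q) \<union> ?ins ` (F \<times> ?T B q)"
    proof (cases "S \<inter> F = {}")
      case True
      then show ?thesis using sub card inj by (auto simp: partial_transversals_def)
    next
      case False
      then obtain z where z: "z \<in> S" "z \<in> F" by blast
      have "S - {z} \<subseteq> B"
      proof
        fix y assume y: "y \<in> S - {z}"
        then have "f y \<noteq> f z" using inj z by (auto dest: inj_onD)
        then have "y \<notin> F" using F z by auto
        then show "y \<in> B" using y sub by auto
      qed
      then have "S - {z} \<in> ?T B q"
        using card z inj_on_subset[OF inj, of "S - {z}"] by (simp add: partial_transversals_def)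
      moreover have "S = ?ins (z, S - {z})" using z by auto
      ultimately show ?thesis using z by blast
    qed
  next
    fix S assume "S \<in> ?T B (Suc q) \<union> ?ins ` (F \<times> ?T B q)"
    then show "S \<in> ?T (B \<union> F) (Suc q)"
    proof
      assume "S \<in> ?T B (Suc q)"
      then show ?thesis by (auto simp: partial_transversals_def)
    next
      assume "S \<in> ?ins ` (F \<times> ?T B q)"
      then obtain z S' where S: "S = insert z S'" "z \<in> F" "S' \<in> ?T B q" by auto
      then have S': "S' \<subseteq> B" "card S' = q" "inj_on f S'" by (auto simp: partial_transversals_def)
      have "finite S'" using S'(1) fin finite_subset by blast
      moreover have "z \<notin> S'" using S'(1) S(2) disj by blast
      moreover have "f y \<noteq> f z" if "y \<in> S'" for y
        using F[OF S(2)] B[of y] S'(1) that by auto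
      then have "f z \<notin> f ` S'" by force
      ultimately show ?thesis using S S' by (auto simp: partial_transversals_def)
    qed
  qed
  have inj: "inj_on ?ins (F \<times> ?T B q)"
  proof (rule inj_onI, clarify)
    fix z S z' S'
    assume a: "z \<in> F" "S \<in> ?T B q" "z' \<in> F" "S' \<in> ?T B q" "insert z S = insert z' S'"
    then have sub: "S \<subseteq> B" "S' \<subseteq> B" by (auto simp: partial_transversals_def)
    have "insert z S \<inter> F = {z}" "insert z' S' \<inter> F = {z'}" using a sub disj by auto
    then have "z = z'" using a(5) by auto
    moreover have "insert z S \<inter> B = S" "insert z' S' \<inter> B = S'" using a sub disj by auto
    then have "S = S'" using a(5) by auto
    ultimately show "z = z' \<and> S = S'" by simp
  qed
  have "?T B (Suc q) \<inter> ?ins ` (F \<times> ?T B q) = {}"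
    using disj by (auto simp: partial_transversals_def)
  then have "card (?T (B \<union> F) (Suc q)) = card (?T B (Suc q)) + card (?ins ` (F \<times> ?T B q))"
    unfolding split 
    by (intro card_Un_disjoint finite_imageI finite_cartesian_product
        finite_partial_transversals fin)
  also have "card (?ins ` (F \<times> ?T B q)) = card F * card (?T B q)"
    by (simp add: card_image[OF inj] card_cartesian_product)
  finally show ?thesis .
qed

text \<open>Induction step of Newton's identity when a variable \<open>x\<close> is added. The new powers contribute
  \<open>\<Sum>\<^sub>k (-1)\<^sup>k (e(m - k) + x e(m - k - 1)) x\<^bsup>k + 1\<^esup>\<close>, which telescopes to \<open>x e(m)\<close>; the old power sums
  contribute the old identity for \<open>m + 1\<close> and \<open>x\<close> times the one for \<open>m\<close>.\<close>

lemma newton_identity_insert: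
  fixes e e' p :: "nat \<Rightarrow> real" and x :: real
  assumes e'0: "e' 0 = e 0" and e'Suc: "\<And>m. e' (Suc m) = e (Suc m) + x * e m"
    and newton: "\<And>m. real (Suc m) * e (Suc m) = (\<Sum>k\<le>m. (-1) ^ k * e (m - k) * p (Suc k))"
  shows "real (Suc m) * e' (Suc m) = (\<Sum>k\<le>m. (-1) ^ k * e' (m - k) * (p (Suc k) + x ^ Suc k))"
proof -
  have geometric: "(\<Sum>k\<le>m. (-1) ^ k * e' (m - k) * x ^ Suc k) = x * e m" for m
  proof (induction m)
    case (Suc m)
    have "(\<Sum>k\<le>Suc m. (-1) ^ k * e' (Suc m - k) * x ^ Suc k) =
      x * e' (Suc m) - x * (\<Sum>k\<le>m. (-1) ^ k * e' (m - k) * x ^ Suc k)"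
      by (subst sum.atMost_Suc_shift)
        (simp add: sum_distrib_left sum_negf mult_ac del: sum.atMost_Suc)
    then show ?case unfolding Suc.IH by (simp only: e'Suc) (simp add: algebra_simps)
  qed (simp add: e'0)
  have old: "(\<Sum>k\<le>m. (-1) ^ k * e' (m - k) * p (Suc k)) = real (Suc m) * e (Suc m) + x * (real m * e m)"
  proof (cases m)
    case 0
    then show ?thesis using newton[of 0] by (simp add: e'0)
  next
    case (Suc n)
    have "(\<Sum>k\<le>Suc n. (-1) ^ k * e' (Suc n - k) * p (Suc k)) =
       (\<Sum>k\<le>n. (-1) ^ k * e' (Suc n - k) * p (Suc k)) + (-1) ^ Suc n * e 0 * p (Suc (Suc n))"
      by (simp add: e'0)
    also have "(\<Sum>k\<le>n. (-1) ^ k * e' (Suc n - k) * p (Suc k)) =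
       (\<Sum>k\<le>n. (-1) ^ k * e (Suc n - k) * p (Suc k) + x * ((-1) ^ k * e (n - k) * p (Suc k)))"
      by (intro sum.cong refl) (simp add: Suc_diff_le e'Suc algebra_simps)
    also have "\<dots> = (\<Sum>k\<le>n. (-1) ^ k * e (Suc n - k) * p (Suc k)) + x * (real (Suc n) * e (Suc n))"
      by (simp only: newton sum.distrib sum_distrib_left)
    finally show ?thesis using newton[of "Suc n"] Suc by simp
  qed
  show ?thesis using geometric[of m] old
    by (simp add: e'Suc distrib_left sum.distrib algebra_simps)
qed

lemma newton_identity_partial_transversals:
  assumes "finite B"
  shows "real (Suc m) * real (card (partial_transversals f B (Suc m))) =
    (\<Sum>k\<le>m. (-1) ^ k * real (card (partial_transversals f B (m - k))) *
       (\<Sum>l\<in>f ` B. real (card {z \<in> B. f z = l}) ^ Suc k))"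
proof -
  let ?e = "\<lambda>A q. real (card (partial_transversals f {z \<in> B. f z \<in> A} q))"
  let ?p = "\<lambda>A k. \<Sum>l\<in>A. real (card {z \<in> B. f z = l}) ^ k"
  have "real (Suc m) * ?e A (Suc m) = (\<Sum>k\<le>m. (-1) ^ k * ?e A (m - k) * ?p A (Suc k))"
    if "finite A" for A m
    using that
  proof (induction A arbitrary: m rule: finite_induct)
    case empty
    have "partial_transversals f {} (Suc m) = {}" by (auto simp: partial_transversals_def)
    then show ?case by simp
  next
    case (insert l A)
    have un: "{z \<in> B. f z \<in> insert l A} = {z \<in> B. f z \<in> A} \<union> {z \<in> B. f z = l}" by auto
    have "real (Suc m) * ?e (insert l A) (Suc m) = (\<Sum>k\<le>m. (-1) ^ k * ?e (insert l A) (m - k) *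
        (?p A (Suc k) + real (card {z \<in> B. f z = l}) ^ Suc k))"
    proof (rule newton_identity_insert[where e = "?e A"])
      show "?e (insert l A) 0 = ?e A 0" using assms by (simp add: partial_transversals_0)
      show "?e (insert l A) (Suc m) = ?e A (Suc m) + real (card {z \<in> B. f z = l}) * ?e A m" for m
        unfolding un
        by (subst card_partial_transversals_add_fibre[where l = l]) (use assms insert in auto)
    qed (rule insert.IH)
    then show ?case using insert by (simp add: add.commute)
  qed
  from this[of "f ` B" m] assms show ?thesis by (simp cong: conj_cong)
qed

section \<open>Summation of polynomials\<close>

text \<open>Polynomial summation. The backward difference of \<open>x\<^bsup>m + 1\<^esup>\<close> has degree \<open>m\<close> and leading coefficient
  \<open>m + 1\<close>, so a multiple of it removes the top term of \<open>w\<close>.\<close>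

lemma ex_poly_antidifference:
  fixes w :: "real poly"
  shows "\<exists>S. poly S 0 = 0 \<and> S - pcompose S [:-1, 1:] = w \<and> degree S \<le> Suc (degree w)"
proof (induction "degree w" arbitrary: w rule: less_induct)
  case less
  define m where "m = degree w"
  define a where "a = coeff w m / real (Suc m)"
  define S0 where "S0 = smult a (monom 1 (Suc m))"
  define w' where "w' = w - (S0 - pcompose S0 [:-1, 1:])"
  have shift: "pcompose S0 [:-1, 1:] = smult a ([:-1, 1:] ^ Suc m)"
    by (simp add: poly_eq_poly_eq_iff[symmetric] fun_eq_iff S0_def poly_pcompose poly_monom
             algebra_simps)
  have coeff_shift: "coeff (pcompose S0 [:-1, 1:]) i =
      a * (real (Suc m choose i) * (-1) ^ (Suc m - i))" if "i \<le> Suc m" for i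
    unfolding shift coeff_smult using that by (subst coeff_linear_poly_power) simp_all
  have degS0: "degree S0 \<le> Suc m" by (simp add: S0_def degree_monom_le)
  have "degree (pcompose S0 [:-1, 1:]) \<le> Suc m"
    using degree_pcompose_le[of S0 "[:-1, 1:]"] degS0 by simp
  then have top: "coeff w' i = 0" if i: "i \<ge> m" for i
  proof -
    consider "i = m" | "i = Suc m" | "i > Suc m" using i by linarith
    then show ?thesis
    proof cases
      case 1
      have "coeff S0 m = 0" by (simp add: S0_def)
      moreover have "coeff (pcompose S0 [:-1, 1:]) m = - (a * real (Suc m))"
        by (simp add: coeff_shift del: of_nat_Suc)
      moreover have "a * real (Suc m) = coeff w m" by (simp add: a_def del: of_nat_Suc)
      ultimately show ?thesis by (simp add: w'_def 1)
    next
      case 2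
      have "coeff S0 (Suc m) = a" by (simp add: S0_def)
      moreover have "coeff (pcompose S0 [:-1, 1:]) (Suc m) = a" by (simp add: coeff_shift)
      ultimately show ?thesis by (simp add: w'_def 2 m_def coeff_eq_0)
    next
      case 3
      with \<open>degree (pcompose S0 [:-1, 1:]) \<le> Suc m\<close> degS0 show ?thesis
        by (simp add: w'_def m_def coeff_eq_0)
    qed
  qed
  have "\<exists>S. poly S 0 = 0 \<and> S - pcompose S [:-1, 1:] = w' \<and> degree S \<le> Suc m"
  proof (cases "w' = 0")
    case True
    then show ?thesis by (intro exI[of _ 0]) simp
  next
    case False
    then have "degree w' < degree w" using top by (intro degree_lessI) (auto simp: m_def)
    from less.hyps[OF this] this show ?thesis by (force simp: m_def)
  qed
  then obtain S where S: "poly S 0 = 0" "S - pcompose S [:-1, 1:] = w'" "degree S \<le> Suc m" by blast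
  show ?case
  proof (intro exI[of _ "S + S0"] conjI)
    show "poly (S + S0) 0 = 0" using S by (simp add: S0_def poly_monom)
    show "(S + S0) - pcompose (S + S0) [:-1, 1:] = w"
    proof -
      have "(S + S0) - pcompose (S + S0) [:-1, 1:] =
          (S - pcompose S [:-1, 1:]) + (S0 - pcompose S0 [:-1, 1:])"
        by (simp add: pcompose_add)
      then show ?thesis by (simp add: S(2) w'_def)
    qed
    show "degree (S + S0) \<le> Suc (degree w)"
      using S(3) degS0 by (simp add: degree_add_le m_def)
  qed
qed

lemma sum_poly_antidifference:
  fixes S w :: "real poly"
  assumes "poly S 0 = 0" and "S - pcompose S [:-1, 1:] = w"
  shows "(\<Sum>j=1..N. poly w (real j)) = poly S (real N)"
proof (induction N)
  case (Suc N)
  have "poly w (real (Suc N)) = poly S (real (Suc N)) - poly S (real N)"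
    unfolding assms(2)[symmetric] by (simp add: poly_pcompose)
  then show ?case using Suc by simp
qed (simp add: assms)

text \<open>This allows an identity in the shift \<open>t\<close> to be checked at natural numbers only.\<close>

lemma coeff_pcompose_poly_in_shift:
  fixes S :: "real poly"
  shows "\<exists>g. \<forall>t. coeff (pcompose S [:-t, b:]) i = poly g t"
proof (induction S arbitrary: i)
  case 0
  show ?case by (intro exI[of _ 0]) simp
next
  case (pCons a S)
  from pCons.IH obtain g where g: "\<And>i t. coeff (pcompose S [:-t, b:]) i = poly (g i) t" by metis
  show ?case
  proof (cases i)
    case 0
    show ?thesis
      by (intro exI[of _ "[:a:] - [:0, 1:] * g 0"])
         (simp add: 0 pcompose_pCons coeff_mult g[of _ 0, symmetric])
  next
    case (Suc j)
    show ?thesis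
      by (intro exI[of _ "smult b (g j) - [:0, 1:] * g (Suc j)"])
         (auto simp: Suc pcompose_pCons g algebra_simps)
  qed
qed

lemma poly_periodic_const:
  fixes g :: "real poly"
  assumes "\<And>t. poly g (real (Suc t)) = poly g (real t)"
  shows "poly g x = poly g 0"
proof -
  have "poly g (real t) = poly g 0" for t by (induction t) (simp_all add: assms del: of_nat_Suc)
  then have "range real \<subseteq> {x. poly (g - [:poly g 0:]) x = 0}" by auto
  moreover have "infinite (range real)" by (simp add: finite_image_iff inj_on_def)
  ultimately have "g - [:poly g 0:] = 0" using poly_roots_finite finite_subset by blast
  then have "g = [:poly g 0:]" by simp
  then have "poly g x = poly [:poly g 0:] x" by (rule arg_cong)
  then show ?thesis by simp
qed

definition second_difference_power :: "nat \<Rightarrow> real poly" where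
  "second_difference_power k = [:1, 1:] ^ k - smult 2 (monom 1 k) + [:-1, 1:] ^ k"

lemma poly_second_difference_power:
  "poly (second_difference_power k) x = (x + 1) ^ k - 2 * x ^ k + (x - 1) ^ k"
  by (simp add: second_difference_power_def poly_monom add.commute)

text \<open>Each of the two differences lowers the degree by one.\<close>

lemma degree_second_difference_power:
  assumes "k \<ge> 2"
  shows "degree (second_difference_power k) \<le> k - 2"
proof (rule degree_le, intro allI impI)
  fix i assume i: "i > k - 2"
  have deg: "degree ([:a, 1:] ^ k) \<le> k" for a :: real
    using degree_power_le[of "[:a, 1:]" k] by simp
  consider "i = k - 1" | "i = k" | "i > k" using i by linarith
  then show "coeff (second_difference_power k) i = 0"
  proof cases
    case 1
    then show ?thesis using assms
      by (simp add: second_difference_power_def coeff_linear_poly_power)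
  next
    case 2
    then show ?thesis
      by (simp add: second_difference_power_def coeff_linear_poly_power)
  next
    case 3
    then have "coeff ([:a, 1:] ^ k) i = 0" for a :: real
      using deg[of a] by (intro coeff_eq_0) simp
    then show ?thesis using 3 by (simp add: second_difference_power_def)
  qed
qed

lemma sum_second_difference_power:
  assumes "k \<ge> 1"
  shows "(\<Sum>j=1..s. poly (second_difference_power k) (real j)) = (real s + 1) ^ k - real s ^ k - 1"
  using assms
  by (induction s) (simp_all add: poly_second_difference_power algebra_simps)

text \<open>Summation by parts, applied twice. The truncated subtraction \<open>s - j\<close> is what a segment of length
  \<open>s\<close> contributes to the count of pairs at distance \<open>j\<close>, and it lets the range of summation be extended
  to a bound \<open>J\<close> common to all lines.\<close>

lemma power_eq_sum_second_difference:
  assumes "k \<ge> 1" "s \<le> J"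
  shows "real s ^ k = real s + (\<Sum>j=1..J. poly (second_difference_power k) (real j) * real (s - j))"
proof -
  let ?w = "\<lambda>j. poly (second_difference_power k) (real j)"
  have "(\<Sum>j=1..s. ?w j * real (s - j)) = real s ^ k - real s"
  proof (induction s)
    case 0
    show ?case using assms(1) by (cases k) simp_all
  next
    case (Suc s)
    have "(\<Sum>j=1..Suc s. ?w j * real (Suc s - j)) = (\<Sum>j=1..s. ?w j * real (Suc s - j))"
      by simp
    also have "\<dots> = (\<Sum>j=1..s. ?w j * real (s - j) + ?w j)"
      by (intro sum.cong refl) (simp add: Suc_diff_le distrib_left)
    also have "\<dots> = (real s + 1) ^ k - (real s + 1)"
      unfolding sum.distrib Suc.IH sum_second_difference_power[OF assms(1)] by simp
    finally show ?case by (simp only: of_nat_Suc add.commute)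
  qed
  moreover have "(\<Sum>j=1..s. ?w j * real (s - j)) = (\<Sum>j=1..J. ?w j * real (s - j))"
    using assms(2) by (intro sum.mono_neutral_left) auto
  ultimately show ?thesis by linarith
qed

section \<open>Dependence of the rectangle sums on the residue\<close>

text \<open>Here \<open>d (N + t)\<close> stands for the board size \<open>n\<close>, so that \<open>t\<close> is the residue divided by \<open>d\<close>, and \<open>H t\<close> is
  the sum as a polynomial in \<open>n\<close> for fixed \<open>t\<close>. Substituting \<open>N = n / d - t\<close> into antidifferences of \<open>w\<close>,
  \<open>x w\<close> and \<open>x\<^sup>2 w\<close> defines \<open>H t\<close> for all real \<open>t\<close>. Passing from \<open>t\<close> to \<open>t + 1\<close> at fixed \<open>n\<close> lowers \<open>N\<close> by
  one, hence removes the summand \<open>j = N\<close>; its factor \<open>n - N d\<close> is the constant \<open>d t\<close>, so the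
  difference has degree at most \<open>k - 1\<close>. A coefficient of \<open>H t\<close> is a polynomial in \<open>t\<close>; for degrees at
  least \<open>k\<close> it is invariant under \<open>t \<mapsto> t + 1\<close>, hence constant. For \<open>k = 2\<close> the linear coefficient drops by
  a known multiple of \<open>t\<close> in each step, which determines it up to a constant.\<close>

lemma ex_rectangle_sum_poly:
  fixes w :: "real poly" and c d :: real
  assumes d: "d > 0" and k: "k \<ge> 2" and w: "degree w \<le> k - 2"
  shows "\<exists>H. (\<forall>N t. poly (H t) (d * (real N + t)) =
        (\<Sum>j=1..N. poly w (real j) * ((d * (real N + t) - real j * c) * (d * (real N + t) - real j * d)))) \<and>
      (\<forall>t. degree (H t) \<le> Suc k) \<and>
      (\<forall>t. \<forall>i\<ge>k. coeff (H t) i = coeff (H 0) i) \<and>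
      (k = 2 \<longrightarrow> (\<forall>t. coeff (H t) 1 - coeff (H 0) 1 = coeff w 0 * (d - c) * t * (1 - t) / 2))"
proof -
  define X :: "real poly" where "X = [:0, 1:]"
  have degX: "degree X = 1" by (simp add: X_def)
  obtain S0 where S0: "poly S0 0 = 0" "S0 - pcompose S0 [:-1, 1:] = w" "degree S0 \<le> Suc (degree w)"
    using ex_poly_antidifference by blast
  obtain S1 where S1: "poly S1 0 = 0" "S1 - pcompose S1 [:-1, 1:] = X * w" "degree S1 \<le> Suc (degree (X * w))"
    using ex_poly_antidifference by blast
  obtain S2 where S2: "poly S2 0 = 0" "S2 - pcompose S2 [:-1, 1:] = X\<^sup>2 * w" "degree S2 \<le> Suc (degree (X\<^sup>2 * w))"
    using ex_poly_antidifference by blast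
  define L where "L t = [:-t, 1 / d:]" for t
  have degL: "degree (L t) = 1" for t using d by (simp add: L_def)
  \<comment> \<open>expand \<open>(x - j c) (x - j d) = x\<^sup>2 - (c + d) x j + c d j\<^sup>2\<close> and sum over \<open>j\<close>\<close>
  define H where "H t = X\<^sup>2 * pcompose S0 (L t) - smult (c + d) (X * pcompose S1 (L t)) +
      smult (c * d) (pcompose S2 (L t))" for t
  have eval: "poly (H t) (d * (real N + t)) =
      (\<Sum>j=1..N. poly w (real j) * ((d * (real N + t) - real j * c) * (d * (real N + t) - real j * d)))"
    for N t
  proof -
    define x where "x = d * (real N + t)"
    have "poly (L t) x = real N" using d by (simp add: L_def x_def)
    then have "poly (H t) x = x\<^sup>2 * poly S0 (real N) - (c + d) * (x * poly S1 (real N)) + c * d * poly S2 (real N)"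
      by (simp add: H_def poly_pcompose X_def)
    also have "\<dots> = (\<Sum>j=1..N. x\<^sup>2 * poly w (real j) - (c + d) * (x * poly (X * w) (real j)) +
        c * d * poly (X\<^sup>2 * w) (real j))"
      unfolding sum_poly_antidifference[OF S0(1,2), symmetric]
        sum_poly_antidifference[OF S1(1,2), symmetric] sum_poly_antidifference[OF S2(1,2), symmetric]
      by (simp only: sum.distrib sum_subtractf sum_distrib_left)
    also have "\<dots> = (\<Sum>j=1..N. poly w (real j) * ((x - real j * c) * (x - real j * d)))"
      by (intro sum.cong refl) (simp add: X_def power2_eq_square algebra_simps)
    finally show ?thesis by (simp only: x_def)
  qed
  have degXw: "degree (X * w) \<le> k - 1" "degree (X\<^sup>2 * w) \<le> k"
  proof -
    show "degree (X * w) \<le> k - 1" using degree_mult_le[of X w] w k degX by linarith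
    have "degree (X\<^sup>2) \<le> 2" using degree_power_le[of X 2] degX by simp
    then show "degree (X\<^sup>2 * w) \<le> k" using degree_mult_le[of "X\<^sup>2" w] w k by linarith
  qed
  have deg: "degree (H t) \<le> Suc k" for t
  proof -
    have comp: "degree (pcompose S (L t)) \<le> degree S" for S
      using degree_pcompose_le[of S "L t"] degL[of t] by simp
    have "degree (X\<^sup>2 * pcompose S0 (L t)) \<le> Suc k"
      using degree_mult_le[of "X\<^sup>2" "pcompose S0 (L t)"] degree_power_le[of X 2] degX comp[of S0] S0(3) w k
      by simp
    moreover have "degree (smult (c + d) (X * pcompose S1 (L t))) \<le> Suc k"
      using degree_smult_le[of "c + d" "X * pcompose S1 (L t)"] degree_mult_le[of X "pcompose S1 (L t)"]
        degX comp[of S1] S1(3) degXw k by linarith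
    moreover have "degree (smult (c * d) (pcompose S2 (L t))) \<le> Suc k"
      using degree_smult_le[of "c * d" "pcompose S2 (L t)"] comp[of S2] S2(3) degXw k by linarith
    ultimately show ?thesis unfolding H_def by (intro degree_add_le degree_diff_le)
  qed
  have step: "H t - H (t + 1) = smult (d * t) (pcompose w (L t) * [:c * t, 1 - c / d:])" for t
  proof -
    have Lstep: "L (t + 1) = pcompose [:-1, 1:] (L t)" by (simp add: L_def pcompose_pCons)
    have comp: "pcompose S (L t) - pcompose S (L (t + 1)) = pcompose (S - pcompose S [:-1, 1:]) (L t)" for S
      by (simp add: Lstep pcompose_assoc pcompose_diff)
    have "H t - H (t + 1) = X\<^sup>2 * (pcompose S0 (L t) - pcompose S0 (L (t + 1))) -
        smult (c + d) (X * (pcompose S1 (L t) - pcompose S1 (L (t + 1)))) +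
        smult (c * d) (pcompose S2 (L t) - pcompose S2 (L (t + 1)))"
      by (simp add: H_def algebra_simps smult_diff_right)
    also have "\<dots> = X\<^sup>2 * pcompose w (L t) - smult (c + d) (X * (L t * pcompose w (L t))) +
        smult (c * d) ((L t)\<^sup>2 * pcompose w (L t))"
      unfolding comp S0 S1 S2
      by (simp add: pcompose_mult power2_eq_square X_def pcompose_pCons mult.assoc)
    also have "\<dots> = smult (d * t) (pcompose w (L t) * [:c * t, 1 - c / d:])"
      using d by (simp add: poly_eq_poly_eq_iff[symmetric] fun_eq_iff X_def L_def field_simps power2_eq_square)
    finally show ?thesis .
  qed
  have coeff_poly: "\<exists>g. \<forall>t. coeff (H t) i = poly g t" for i
  proof -
    have "\<forall>S i. \<exists>g. \<forall>t. coeff (pcompose S (L t)) i = poly g t"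
      unfolding L_def using coeff_pcompose_poly_in_shift by blast
    then obtain g where g: "coeff (pcompose S (L t)) i = poly (g S i) t" for S i t by metis
    have coeff_X: "coeff (X * p) i = (if i < 1 then 0 else coeff p (i - 1))" for p
      using coeff_monom_mult[of 1 1 p i] by (simp add: X_def monom_altdef)
    have coeff_X2: "coeff (X\<^sup>2 * p) i = (if i < 2 then 0 else coeff p (i - 2))" for p
      using coeff_monom_mult[of 1 2 p i] by (simp add: X_def monom_altdef)
    show ?thesis
      by (rule exI[of _ "(if i < 2 then 0 else g S0 (i - 2)) -
           smult (c + d) (if i < 1 then 0 else g S1 (i - 1)) + smult (c * d) (g S2 i)"])
         (simp add: H_def coeff_X coeff_X2 g del: pcompose_coeff_0)
  qed
  have top: "coeff (H t) i = coeff (H 0) i" if i: "i \<ge> k" for t i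
  proof -
    obtain g where g: "\<And>t. coeff (H t) i = poly g t" using coeff_poly[of i] by blast
    have "poly g (real (Suc n)) = poly g (real n)" for n
    proof -
      have "degree (pcompose w (L (real n)) * [:c * real n, 1 - c / d:]) \<le> k - 1"
        using degree_mult_le[of "pcompose w (L (real n))" "[:c * real n, 1 - c / d:]"]
          degree_pcompose_le[of w "L (real n)"] degL[of "real n"] w k
          degree_pCons_le[of "c * real n" "[:1 - c / d:]"] by simp
      then have "coeff (pcompose w (L (real n)) * [:c * real n, 1 - c / d:]) i = 0"
        using i k by (intro coeff_eq_0) linarith
      then have "coeff (H (real n) - H (real n + 1)) i = 0"
        unfolding step coeff_smult by simp
      then show ?thesis using g[of "real n"] g[of "real n + 1"] by (simp add: add.commute)
    qed
    then show ?thesis using poly_periodic_const[of g t] g by simp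
  qed
  have two: "coeff (H t) 1 - coeff (H 0) 1 = coeff w 0 * (d - c) * t * (1 - t) / 2" if k2: "k = 2" for t
  proof -
    define a where "a = coeff w 0"
    have wa: "w = [:a:]" using w k2 by (auto simp: a_def intro: degree_0_id[symmetric])
    obtain g where g: "\<And>t. coeff (H t) 1 = poly g t" using coeff_poly[of 1] by blast
    \<comment> \<open>\<open>t (1 - t) / 2\<close> drops by \<open>t\<close> under \<open>t \<mapsto> t + 1\<close>, so that \<open>g'\<close> is invariant\<close>
    define g' where "g' = g - smult (a * (d - c) / 2) ([:0, 1:] * [:1, -1:])"
    have "poly g' (real (Suc n)) = poly g' (real n)" for n
    proof -
      have "coeff (H (real n) - H (real n + 1)) 1 = a * (d - c) * real n"
        unfolding step using d by (simp add: wa field_simps)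
      then have "poly g (real n) - poly g (real n + 1) = a * (d - c) * real n"
        using g[of "real n"] g[of "real n + 1"] by simp
      then show ?thesis by (simp add: g'_def field_simps)
    qed
    then have "poly g' t = poly g' 0" by (rule poly_periodic_const)
    then have "poly g t - a * (d - c) / 2 * (t * (1 - t)) = poly g 0"
      unfolding g'_def poly_diff poly_smult poly_mult by simp
    then show ?thesis unfolding g a_def by simp
  qed
  show ?thesis
    using eval deg top two by (intro exI[of _ H] conjI allI impI)
qed

section \<open>Power sums of the line sizes\<close>

text \<open>For coprime \<open>c\<close> and \<open>d\<close>, the level sets of this linear form are exactly the lines along which
  the rider with move \<open>(c, d)\<close> attacks.\<close>

definition line_label :: "int \<Rightarrow> int \<Rightarrow> int \<times> int \<Rightarrow> int" where
  "line_label c d z = d * fst z - c * snd z"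

lemma attacks_iff_line_label:
  assumes "coprime c d" "d > 0"
  shows "attacks {(c, d)} z z' \<longleftrightarrow> line_label c d z = line_label c d z'"
proof
  assume "attacks {(c, d)} z z'"
  then obtain k where "fst z' = fst z + k * c" "snd z' = snd z + k * d"
    by (auto simp: attacks_def algebra_simps)
  then show "line_label c d z = line_label c d z'"
    by (simp add: line_label_def algebra_simps)
next
  assume "line_label c d z = line_label c d z'"
  then have eq: "d * (fst z' - fst z) = c * (snd z' - snd z)"
    by (simp add: line_label_def algebra_simps)
  then have "d dvd c * (snd z' - snd z)" by (metis dvd_triv_left)
  then have "d dvd snd z' - snd z"
    using assms(1) by (simp add: coprime_commute coprime_dvd_mult_right_iff)
  then obtain k where k: "snd z' - snd z = k * d" by (metis dvdE mult.commute)
  then have "d * (fst z' - fst z) = d * (k * c)" using eq by (simp add: mult_ac)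
  then have "fst z' - fst z = k * c" using assms(2) by simp
  with k show "attacks {(c, d)} z z'" by (auto simp: attacks_def)
qed

lemma nonattacking_placements_eq_partial_transversals:
  assumes "coprime c d" "d > 0"
  shows "nonattacking_placements {(c, d)} q n = partial_transversals (line_label c d) (board n) q"
  unfolding nonattacking_placements_def partial_transversals_def inj_on_def
    attacks_iff_line_label[OF assms]
  by (intro Collect_cong) auto

definition move :: "int \<Rightarrow> int \<Rightarrow> int \<Rightarrow> int \<times> int \<Rightarrow> int \<times> int" where
  "move c d j z = (fst z + j * c, snd z + j * d)"

lemma finite_board: "finite (board n)"
  by (simp add: board_def)

lemma finite_convex_int_set:
  fixes K :: "int set"
  assumes "finite K" "K \<noteq> {}" and convex: "\<And>i j k. i \<in> K \<Longrightarrow> k \<in> K \<Longrightarrow> i \<le> j \<Longrightarrow> j \<le> k \<Longrightarrow> j \<in> K"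
  shows "K = {Min K..Max K}"
proof
  show "K \<subseteq> {Min K..Max K}" using assms(1) by auto
  show "{Min K..Max K} \<subseteq> K" using convex[OF Min_in[OF assms(1,2)] Max_in[OF assms(1,2)]] by auto
qed

text \<open>Neither coordinate decreases along the move and the second one increases, so the squares of the board on one line are consecutive:
  they correspond to an integer interval of multiples of \<open>(c, d)\<close>.\<close>

lemma card_line_move:
  assumes cd: "coprime c d" "0 \<le> c" "d > 0"
  shows "card {z \<in> board n. line_label c d z = l \<and> move c d (int j) z \<in> board n} =
    card {z \<in> board n. line_label c d z = l} - j"
proof (cases "{z \<in> board n. line_label c d z = l} = {}")
  case True
  then have e: "{z \<in> board n. line_label c d z = l \<and> move c d (int j) z \<in> board n} = {}" by blast
  show ?thesis unfolding e True by simp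
next
  case False
  then obtain z0 where z0: "z0 \<in> board n" "line_label c d z0 = l" by blast
  define K where "K = {i. move c d i z0 \<in> board n}"
  let ?m = "\<lambda>i. move c d i z0"
  have inj: "inj_on ?m A" for A using cd by (auto simp: inj_on_def move_def)
  have line: "{z \<in> board n. line_label c d z = l} = ?m ` K"
  proof (intro set_eqI iffI)
    fix z assume z: "z \<in> {z \<in> board n. line_label c d z = l}"
    then have "attacks {(c, d)} z0 z" using z0 attacks_iff_line_label[OF cd(1,3)] by simp
    then obtain k where "z = ?m k"
      by (auto simp: attacks_def move_def algebra_simps prod_eq_iff)
    then show "z \<in> ?m ` K" using z by (auto simp: K_def)
  next
    fix z assume "z \<in> ?m ` K"
    then show "z \<in> {z \<in> board n. line_label c d z = l}"
      using z0 by (auto simp: K_def line_label_def move_def algebra_simps)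
  qed
  have "finite (?m ` K)" unfolding line[symmetric] using finite_board by simp
  then have fin: "finite K" using inj finite_imageD by blast
  have ne: "K \<noteq> {}" using z0 by (auto simp: K_def move_def intro!: exI[of _ 0])
  have convex: "j \<in> K" if "i \<in> K" "k \<in> K" "i \<le> j" "j \<le> k" for i j k
  proof -
    have "i * c \<le> j * c" "j * c \<le> k * c" "i * d \<le> j * d" "j * d \<le> k * d"
      using that cd by (simp_all add: mult_right_mono)
    then show ?thesis using that by (auto simp: K_def move_def board_def)
  qed
  have "K = {Min K..Max K}"
    by (rule finite_convex_int_set[OF fin ne]) (fact convex)
  then obtain a b where K: "K = {a..b}" by blast
  have "{z \<in> board n. line_label c d z = l \<and> move c d (int j) z \<in> board n} =
      {z \<in> ?m ` K. move c d (int j) z \<in> board n}"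
    unfolding line[symmetric] by blast
  also have "\<dots> = ?m ` {i \<in> K. i + int j \<in> K}"
    by (auto simp: K_def move_def algebra_simps)
  also have "{i \<in> K. i + int j \<in> K} = {a..b - int j}" by (auto simp: K)
  finally show ?thesis
    unfolding line by (simp add: card_image[OF inj] K)
qed

lemma card_board_move:
  fixes c d :: nat
  shows "card {z \<in> board n. move (int c) (int d) (int j) z \<in> board n} = (n - j * c) * (n - j * d)"
proof -
  have "{z \<in> board n. move (int c) (int d) (int j) z \<in> board n} =
     {1..int n - int (j * c)} \<times> {1..int n - int (j * d)}"
  proof (intro set_eqI)
    fix z :: "int \<times> int"
    have "0 \<le> int (j * c)" "0 \<le> int (j * d)" by simp_all
    then show "z \<in> {z \<in> board n. move (int c) (int d) (int j) z \<in> board n} \<longleftrightarrow>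
       z \<in> {1..int n - int (j * c)} \<times> {1..int n - int (j * d)}"
      unfolding board_def move_def mem_Collect_eq mem_Times_iff fst_conv snd_conv
        atLeastAtMost_iff of_nat_mult by linarith
  qed
  then show ?thesis by (simp add: card_cartesian_product nat_diff_distrib' flip: of_nat_mult)
qed

lemma sum_card_fibres:
  assumes "finite B"
  shows "(\<Sum>l\<in>f ` B. card {z \<in> B. f z = l \<and> P z}) = card {z \<in> B. P z}"
proof -
  have "(\<Sum>l\<in>f ` B. card {z \<in> B. f z = l \<and> P z}) = (\<Sum>l\<in>f ` B. \<Sum>z\<in>{z \<in> {z \<in> B. P z}. f z = l}. 1)"
    by (intro sum.cong refl) (simp add: conj_commute conj_left_commute)
  also have "\<dots> = (\<Sum>z\<in>{z \<in> B. P z}. 1)"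
    by (rule sum.group) (use assms in auto)
  finally show ?thesis by simp
qed

definition line_power_sum :: "nat \<Rightarrow> nat \<Rightarrow> nat \<Rightarrow> nat \<Rightarrow> real" where
  "line_power_sum c d k n = (\<Sum>l\<in>line_label (int c) (int d) ` board n.
     real (card {z \<in> board n. line_label (int c) (int d) z = l}) ^ k)"

lemma line_power_sum_1: "line_power_sum c d 1 n = (real n)\<^sup>2"
proof -
  have "line_power_sum c d 1 n = real (card (board n))"
    using sum_card_fibres[OF finite_board, where f = "line_label (int c) (int d)" and P = "\<lambda>_. True"]
    by (simp add: line_power_sum_def flip: of_nat_sum)
  then show ?thesis by (simp add: board_def power2_eq_square)
qed

text \<open>Expand each power by second differences and exchange the sums: the lines together contribute, for
  every \<open>j\<close>, the number of squares that stay on the board under \<open>j\<close> moves. The terms with \<open>j d > n\<close>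
  vanish by truncation, and for the others the subtractions are exact.\<close>

lemma line_power_sum_eq:
  assumes cd: "coprime c d" "d > 0" "c \<le> d" and k: "k \<ge> 1"
  shows "line_power_sum c d k n = (real n)\<^sup>2 + (\<Sum>j=1..n div d. poly (second_difference_power k) (real j) *
     ((real n - real j * real c) * (real n - real j * real d)))"
proof -
  let ?B = "board n" and ?f = "line_label (int c) (int d)"
  let ?s = "\<lambda>l. card {z \<in> ?B. ?f z = l}" and ?w = "\<lambda>j. poly (second_difference_power k) (real j)"
  have pairs: "(\<Sum>l\<in>?f ` ?B. real (?s l - j)) = real ((n - j * c) * (n - j * d))" for j
  proof -
    have "(\<Sum>l\<in>?f ` ?B. real (?s l - j)) =
       real (\<Sum>l\<in>?f ` ?B. card {z \<in> ?B. ?f z = l \<and> move (int c) (int d) (int j) z \<in> ?B})"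
      using cd by (subst card_line_move) simp_all
    then show ?thesis by (simp only: sum_card_fibres[OF finite_board] card_board_move)
  qed
  have cB: "card ?B = n * n" by (simp add: board_def)
  have "line_power_sum c d k n =
      (\<Sum>l\<in>?f ` ?B. real (?s l) + (\<Sum>j=1..n * n. ?w j * real (?s l - j)))"
    unfolding line_power_sum_def
  proof (intro sum.cong refl power_eq_sum_second_difference k)
    fix l
    have "?s l \<le> card ?B" by (intro card_mono finite_board) auto
    then show "?s l \<le> n * n" by (simp add: cB)
  qed
  also have "\<dots> = (\<Sum>l\<in>?f ` ?B. real (?s l)) + (\<Sum>j=1..n * n. ?w j * (\<Sum>l\<in>?f ` ?B. real (?s l - j)))"
    by (simp add: sum.distrib sum_distrib_left) (rule sum.swap)
  also have "(\<Sum>l\<in>?f ` ?B. real (?s l)) = (real n)\<^sup>2"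
    using line_power_sum_1[of c d n] by (simp add: line_power_sum_def)
  also have "(\<Sum>j=1..n * n. ?w j * (\<Sum>l\<in>?f ` ?B. real (?s l - j))) =
      (\<Sum>j=1..n * n. ?w j * real ((n - j * c) * (n - j * d)))"
    by (simp only: pairs)
  also have "(\<Sum>j=1..n * n. ?w j * real ((n - j * c) * (n - j * d))) =
      (\<Sum>j=1..n div d. ?w j * real ((n - j * c) * (n - j * d)))"
  proof (rule sum.mono_neutral_right)
    have "n div d \<le> n" by simp
    also have "n \<le> n * n" by simp
    finally show "{1..n div d} \<subseteq> {1..n * n}" by auto
    show "\<forall>j\<in>{1..n * n} - {1..n div d}. ?w j * real ((n - j * c) * (n - j * d)) = 0"
    proof
      fix j assume "j \<in> {1..n * n} - {1..n div d}"
      then have "n div d < j" by auto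
      then have "n < j * d" using cd(2) by (simp add: div_less_iff_less_mult)
      then show "?w j * real ((n - j * c) * (n - j * d)) = 0" by simp
    qed
  qed simp
  also have "\<dots> = (\<Sum>j=1..n div d. ?w j * ((real n - real j * real c) * (real n - real j * real d)))"
  proof (intro sum.cong refl)
    fix j assume "j \<in> {1..n div d}"
    then have jd: "j * d \<le> n" using cd(2) by (simp add: less_eq_div_iff_mult_less_eq)
    have "j * c \<le> j * d" using cd(3) by simp
    then have jc: "j * c \<le> n" using jd by linarith
    show "?w j * real ((n - j * c) * (n - j * d)) =
        ?w j * ((real n - real j * real c) * (real n - real j * real d))"
      using jd jc by (simp add: of_nat_diff)
  qed
  finally show ?thesis .
qed

text \<open>Up to an additive constant, half of the linear coefficient of the sum of squares of the line sizes,
  as a function of the residue \<open>r\<close> of the board size.\<close>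

definition fractional_defect :: "nat \<Rightarrow> nat \<Rightarrow> nat \<Rightarrow> real" where
  "fractional_defect c d r = real r * (real d - real r) * (real d - real c) / (2 * (real d)\<^sup>2)"

lemma ex_line_power_sum_quasipoly:
  assumes cd: "coprime c d" "d > 0" "c \<le> d" and k: "k \<ge> 2"
  shows "\<exists>P. (\<forall>n. line_power_sum c d k n = poly (P (n mod d)) (real n)) \<and>
    (\<forall>r. degree (P r) \<le> Suc k) \<and>
    (\<forall>r. \<forall>i\<ge>k. coeff (P r) i = coeff (P 0) i) \<and>
    (k = 2 \<longrightarrow> (\<forall>r. coeff (P r) 1 - coeff (P 0) 1 = 2 * fractional_defect c d r))"
proof -
  define w where "w = second_difference_power k"
  obtain H where eval: "\<And>N t. poly (H t) (real d * (real N + t)) = (\<Sum>j=1..N. poly w (real j) *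
        ((real d * (real N + t) - real j * real c) * (real d * (real N + t) - real j * real d)))"
    and deg: "\<And>t. degree (H t) \<le> Suc k"
    and top: "\<And>t i. i \<ge> k \<Longrightarrow> coeff (H t) i = coeff (H 0) i"
    and two: "\<And>t. k = 2 \<Longrightarrow> coeff (H t) 1 - coeff (H 0) 1 = coeff w 0 * (real d - real c) * t * (1 - t) / 2"
  proof -
    have "real d > 0" "degree w \<le> k - 2"
      using cd(2) degree_second_difference_power[OF k] by (simp_all add: w_def)
    from ex_rectangle_sum_poly[OF this(1) k this(2), of "real c"] that show ?thesis by blast
  qed
  define P where "P r = monom 1 2 + H (real r / real d)" for r :: nat
  show ?thesis
  proof (intro exI[of _ P] conjI allI impI)
    fix n
    have n: "real d * (real (n div d) + real (n mod d) / real d) = real n"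
    proof -
      have "real d * real (n div d) + real (n mod d) = real n"
        by (metis of_nat_add of_nat_mult mult_div_mod_eq)
      then show ?thesis using cd(2) by (simp add: distrib_left)
    qed
    show "line_power_sum c d k n = poly (P (n mod d)) (real n)"
      using eval[of "real (n mod d) / real d" "n div d"] k
      by (simp add: n line_power_sum_eq[OF cd] P_def w_def poly_monom)
  next
    fix r
    show "degree (P r) \<le> Suc k"
      unfolding P_def by (intro degree_add_le deg order_trans[OF degree_monom_le]) (use k in simp)
    show "coeff (P r) i = coeff (P 0) i" if "i \<ge> k" for i
      using top[OF that, of "real r / real d"] by (simp add: P_def)
    assume k2: "k = 2"
    have "coeff w 0 = 2" by (simp add: w_def k2 poly_0_coeff_0[symmetric] poly_second_difference_power)
    then show "coeff (P r) 1 - coeff (P 0) 1 = 2 * fractional_defect c d r"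
      using two[OF k2, of "real r / real d"] cd(2)
      by (simp add: P_def fractional_defect_def field_simps power2_eq_square)
  qed
qed

section \<open>The counting polynomials on the residue classes\<close>

lemma coeff_mult_eq_0_beyond:
  fixes p q :: "'a::comm_semiring_0 poly"
  assumes "\<And>i. i \<ge> a \<Longrightarrow> coeff p i = 0" and "degree q \<le> b" and "i \<ge> a + b"
  shows "coeff (p * q) i = 0"
  unfolding coeff_mult
proof (rule sum.neutral, rule ballI)
  fix j assume "j \<in> {..i}"
  show "coeff p j * coeff q (i - j) = 0"
  proof (cases "j \<ge> a")
    case False
    then have "i - j > degree q" using assms by linarith
    then show ?thesis by (simp add: coeff_eq_0)
  qed (simp add: assms)
qed

text \<open>Degree bounds instead of exact degrees make this usable when the coefficients in question may
  vanish.\<close>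

lemma coeff_mult_top:
  fixes p q :: "'a::comm_semiring_0 poly"
  assumes "degree p \<le> a" and "\<And>i. i > b \<Longrightarrow> coeff q i = 0"
  shows "coeff (p * q) (a + b) = coeff p a * coeff q b"
proof -
  have "coeff p j * coeff q (a + b - j) = 0" if "j \<in> {..a + b} - {a}" for j
  proof (cases "j > a")
    case True
    then have "degree p < j" using assms(1) by simp
    then show ?thesis by (simp add: coeff_eq_0)
  next
    case False
    then have "a + b - j > b" using that by auto
    then show ?thesis by (simp add: assms)
  qed
  then have "(\<Sum>j\<le>a + b. coeff p j * coeff q (a + b - j)) = (\<Sum>j\<in>{a}. coeff p j * coeff q (a + b - j))"
    by (intro sum.mono_neutral_right) auto
  then show ?thesis by (simp add: coeff_mult)
qed

lemma ex_power_sum_polys: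
  assumes cd: "coprime c d" "d > 0" "c \<le> d"
  obtains P where
    "\<And>k n. k \<ge> 1 \<Longrightarrow> line_power_sum c d k n = poly (P k (n mod d)) (real n)"
    "\<And>r. P 1 r = monom 1 2"
    "\<And>k r. k \<ge> 1 \<Longrightarrow> degree (P k r) \<le> Suc k"
    "\<And>k r i. k \<ge> 2 \<Longrightarrow> i \<ge> k \<Longrightarrow> coeff (P k r) i = coeff (P k 0) i"
    "\<And>r. coeff (P 2 r) 1 - coeff (P 2 0) 1 = 2 * fractional_defect c d r"
proof -
  define good where "good k P \<longleftrightarrow> (\<forall>n. line_power_sum c d k n = poly (P (n mod d)) (real n)) \<and>
    (\<forall>r. degree (P r) \<le> Suc k) \<and>
    (\<forall>r. \<forall>i\<ge>k. coeff (P r) i = coeff (P 0) i) \<and>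
    (k = 2 \<longrightarrow> (\<forall>r. coeff (P r) 1 - coeff (P 0) 1 = 2 * fractional_defect c d r))"
    for k :: nat and P :: "nat \<Rightarrow> real poly"
  have "\<forall>k. \<exists>P. k \<ge> 2 \<longrightarrow> good k P"
    using ex_line_power_sum_quasipoly[OF cd] unfolding good_def by blast
  from choice[OF this] obtain P where P: "\<And>k. k \<ge> 2 \<Longrightarrow> good k (P k)" by blast
  show ?thesis
  proof (rule that[of "\<lambda>k r. if k = 1 then monom 1 2 else P k r"])
    show "line_power_sum c d k n = poly (if k = 1 then monom 1 2 else P k (n mod d)) (real n)"
      if "k \<ge> 1" for k n
    proof (cases "k = 1")
      case True
      then show ?thesis using line_power_sum_1[of c d n] by (simp add: poly_monom)
    next
      case False
      then show ?thesis using P[of k] that by (simp add: good_def)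
    qed
    show "degree (if k = 1 then monom 1 2 else P k r) \<le> Suc k" if "k \<ge> 1" for k r
    proof (cases "k = 1")
      case True
      then show ?thesis using degree_monom_le[of "1::real" 2] by simp
    next
      case False
      then show ?thesis using P[of k] that by (simp add: good_def)
    qed
    show "coeff (if k = 1 then monom 1 2 else P k r) i = coeff (if k = 1 then monom 1 2 else P k 0) i"
      if "k \<ge> 2" "i \<ge> k" for k r i
    proof -
      have "coeff (P k r) i = coeff (P k 0) i"
        using P[OF that(1)] that(2) unfolding good_def by blast
      then show ?thesis by simp
    qed
    show "coeff (if (2::nat) = 1 then monom 1 2 else P 2 r) 1 -
        coeff (if (2::nat) = 1 then monom 1 2 else P 2 0) 1 = 2 * fractional_defect c d r" for r
      using P[of 2] by (simp add: good_def)
    show "(if (1::nat) = 1 then monom 1 2 else P 1 r) = monom (1::real) 2" for r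
      by (rule if_P) (rule refl)
  qed
qed

text \<open>Strong induction by Newton's identity, comparing the residue \<open>r\<close> with the residue \<open>0\<close>. The change of
  a product \<open>e\<^sub>a p\<^sub>k\<close> is the change of \<open>e\<^sub>a\<close> times \<open>p\<^sub>k\<close> plus \<open>e\<^sub>a\<close> times the change of \<open>p\<^sub>k\<close>, and degrees decide
  which of these reach the power \<open>2 q - 3\<close>. The leading coefficient \<open>1 / q!\<close> is carried along because it
  multiplies the change of \<open>p\<^sub>2\<close>. The condition \<open>i + 3 \<ge> 2 * q\<close> avoids truncated subtraction; for \<open>q \<le> 1\<close>
  the last clause says that the polynomials for all residues coincide.\<close>

lemma ex_placement_polys:
  assumes cd: "coprime c d" "d > 0" "c \<le> d"
  shows "\<exists>E. (\<forall>n. real (card (partial_transversals (line_label (int c) (int d)) (board n) q)) =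
        poly (E (n mod d)) (real n)) \<and>
      (\<forall>r. degree (E r) \<le> 2 * q \<and> coeff (E r) (2 * q) = 1 / fact q) \<and>
      (\<forall>r i. i + 3 \<ge> 2 * q \<longrightarrow> coeff (E r - E 0) i =
        (if i + 3 = 2 * q then - (fractional_defect c d r / fact (q - 2)) else 0))"
proof (induction q rule: less_induct)
  case (less q)
  let ?N = "\<lambda>q n. real (card (partial_transversals (line_label (int c) (int d)) (board n) q))"
  obtain P where P_eval: "\<And>k n. k \<ge> 1 \<Longrightarrow> line_power_sum c d k n = poly (P k (n mod d)) (real n)"
    and P1: "\<And>r. P 1 r = monom 1 2"
    and P_deg: "\<And>k r. k \<ge> 1 \<Longrightarrow> degree (P k r) \<le> Suc k"
    and P_top: "\<And>k r i. k \<ge> 2 \<Longrightarrow> i \<ge> k \<Longrightarrow> coeff (P k r) i = coeff (P k 0) i"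
    and P2: "\<And>r. coeff (P 2 r) 1 - coeff (P 2 0) 1 = 2 * fractional_defect c d r"
    using ex_power_sum_polys[OF cd] by blast
  show ?case
  proof (cases q)
    case 0
    then show ?thesis
      by (intro exI[of _ "\<lambda>_. 1"]) (simp add: partial_transversals_0 finite_board)
  next
    case (Suc m)
    have "\<forall>a\<in>{..m}. \<exists>E. (\<forall>n. ?N a n = poly (E (n mod d)) (real n)) \<and>
      (\<forall>r. degree (E r) \<le> 2 * a \<and> coeff (E r) (2 * a) = 1 / fact a) \<and>
      (\<forall>r i. i + 3 \<ge> 2 * a \<longrightarrow> coeff (E r - E 0) i =
        (if i + 3 = 2 * a then - (fractional_defect c d r / fact (a - 2)) else 0))"
      using less.IH Suc by simp
    from bchoice[OF this] obtain E where
      E_eval: "\<And>a n. a \<le> m \<Longrightarrow> ?N a n = poly (E a (n mod d)) (real n)"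
      and E_deg: "\<And>a r. a \<le> m \<Longrightarrow> degree (E a r) \<le> 2 * a"
      and E_lead: "\<And>a r. a \<le> m \<Longrightarrow> coeff (E a r) (2 * a) = 1 / fact a"
      and E_diff: "\<And>a r i. a \<le> m \<Longrightarrow> i + 3 \<ge> 2 * a \<Longrightarrow> coeff (E a r - E a 0) i =
        (if i + 3 = 2 * a then - (fractional_defect c d r / fact (a - 2)) else 0)"
      unfolding Ball_def atMost_iff by blast
    define T where "T k r = E (m - k) r * P (Suc k) r" for k r
    define E' where "E' r = smult (1 / real (Suc m)) (\<Sum>k\<le>m. smult ((-1) ^ k) (T k r))" for r
    have coeff_E': "coeff (E' r) i = (\<Sum>k\<le>m. (-1) ^ k * coeff (T k r) i) / real (Suc m)" for r i
      by (simp add: E'_def coeff_sum)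
    have T_deg: "degree (T k r) \<le> 2 * (m - k) + (k + 2)" if "k \<le> m" for k r
    proof -
      have "degree (E (m - k) r) \<le> 2 * (m - k)" "degree (P (Suc k) r) \<le> k + 2"
        using E_deg[of "m - k" r] P_deg[of "Suc k" r] by simp_all
      then show ?thesis
        unfolding T_def using degree_mult_le[of "E (m - k) r" "P (Suc k) r"] by linarith
    qed
    have T0: "coeff (T 0 r) i = (if i < 2 then 0 else coeff (E m r) (i - 2))" for r i
      using coeff_monom_mult[of 1 2 "E m r" i] P1 by (simp add: T_def mult.commute)
    have eval: "?N q n = poly (E' (n mod d)) (real n)" for n
    proof -
      have "real (Suc m) * ?N (Suc m) n =
          (\<Sum>k\<le>m. (-1) ^ k * ?N (m - k) n * line_power_sum c d (Suc k) n)"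
        unfolding line_power_sum_def by (rule newton_identity_partial_transversals[OF finite_board])
      also have "\<dots> = (\<Sum>k\<le>m. (-1) ^ k * poly (T k (n mod d)) (real n))"
        by (intro sum.cong refl) (simp add: E_eval P_eval T_def)
      also have "\<dots> = real (Suc m) * poly (E' (n mod d)) (real n)"
        by (simp add: E'_def poly_sum del: of_nat_Suc)
      finally show ?thesis unfolding Suc by (simp del: of_nat_Suc)
    qed
    have deg: "degree (E' r) \<le> 2 * q" for r
    proof (rule degree_le, intro allI impI)
      fix i assume "i > 2 * q"
      then have "coeff (T k r) i = 0" if "k \<le> m" for k
        using T_deg[OF that, of r] Suc that by (intro coeff_eq_0) linarith
      then show "coeff (E' r) i = 0" by (simp add: coeff_E')
    qed
    have lead: "coeff (E' r) (2 * q) = 1 / fact q" for r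
    proof -
      have "coeff (T k r) (2 * q) = 0" if "k \<in> {..m} - {0}" for k
        using T_deg[of k r] Suc that by (intro coeff_eq_0) auto
      then have "(\<Sum>k\<le>m. (-1) ^ k * coeff (T k r) (2 * q)) = (\<Sum>k\<in>{0}. (-1) ^ k * coeff (T k r) (2 * q))"
        by (intro sum.mono_neutral_right) auto
      also have "\<dots> = 1 / fact m" using E_lead[of m r] by (simp add: T0 Suc)
      finally show ?thesis by (simp add: coeff_E' Suc)
    qed
    have diff: "coeff (E' r - E' 0) i =
        (if i + 3 = 2 * q then - (fractional_defect c d r / fact (q - 2)) else 0)"
      if i: "i + 3 \<ge> 2 * q" for r i
    proof -
      let ?h = "fractional_defect c d r"
      define D where "D k = coeff (T k r - T k 0) i" for k
      have split: "D k = coeff ((E (m - k) r - E (m - k) 0) * P (Suc k) r) i +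
          coeff (E (m - k) 0 * (P (Suc k) r - P (Suc k) 0)) i" for k
        by (simp add: D_def T_def algebra_simps)
      \<comment> \<open>only \<open>k = 0\<close> lets the variation of \<open>E\<close> through, since \<open>P (Suc k)\<close> gains degree more slowly than \<open>E (m - k)\<close> loses it\<close>
      have D_first: "coeff ((E (m - k) r - E (m - k) 0) * P (Suc k) r) i = 0" if k: "1 \<le> k" "k \<le> m" for k
      proof (cases "m - k = 0")
        case True
        then have "E (m - k) r - E (m - k) 0 = 0"
          using E_diff[of 0 _ r] by (intro poly_eqI) simp
        then show ?thesis by simp
      next
        case False
        show ?thesis
        proof (rule coeff_mult_eq_0_beyond)
          show "coeff (E (m - k) r - E (m - k) 0) i' = 0" if "i' \<ge> 2 * (m - k) - 2" for i'
            using E_diff[of "m - k" i' r] that False by auto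
          show "degree (P (Suc k) r) \<le> k + 2" using P_deg[of "Suc k" r] by simp
          show "2 * (m - k) - 2 + (k + 2) \<le> i" using i k Suc False by linarith
        qed
      qed
      have D_rest: "D k = 0" if k: "2 \<le> k" "k \<le> m" for k
      proof -
        have "coeff ((P (Suc k) r - P (Suc k) 0) * E (m - k) 0) i = 0"
        proof (rule coeff_mult_eq_0_beyond)
          show "coeff (P (Suc k) r - P (Suc k) 0) i' = 0" if "i' \<ge> Suc k" for i'
            using P_top[of "Suc k" i' r] that k by simp
          show "degree (E (m - k) 0) \<le> 2 * (m - k)" by (rule E_deg) simp
          show "Suc k + 2 * (m - k) \<le> i" using i k Suc by linarith
        qed
        then show ?thesis using D_first[of k] k by (simp add: split mult.commute)
      qed
      \<comment> \<open>multiplication by \<open>n\<^sup>2\<close> shifts the induction hypothesis; for \<open>m = 1\<close> nothing varies\<close>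
      have D0: "D 0 = (if i + 3 = 2 * q \<and> m \<ge> 2 then - (?h / fact (m - 2)) else 0)"
      proof (cases "i < 2")
        case True
        then show ?thesis using Suc by (auto simp: D_def T0)
      next
        case False
        then have "D 0 = coeff (E m r - E m 0) (i - 2)" by (simp add: D_def T0)
        also have "\<dots> = (if i - 2 + 3 = 2 * m then - (?h / fact (m - 2)) else 0)"
          using i False Suc by (intro E_diff) auto
        also have "i - 2 + 3 = 2 * m \<longleftrightarrow> i + 3 = 2 * q \<and> m \<ge> 2" using False Suc by linarith
        finally show ?thesis .
      qed
      have D1: "D 1 = (if i + 3 = 2 * q then 2 * ?h / fact (m - 1) else 0)" if m: "m \<ge> 1"
      proof -
        have top: "coeff (P (Suc 1) r - P (Suc 1) 0) i' = 0" if "i' > 1" for i'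
          using P_top[of "Suc 1" i' r] that by simp
        have "D 1 = coeff (E (m - 1) 0 * (P (Suc 1) r - P (Suc 1) 0)) i"
          using D_first[of 1] m by (simp add: split)
        also have "\<dots> = (if i + 3 = 2 * q then 2 * ?h / fact (m - 1) else 0)"
        proof (cases "i + 3 = 2 * q")
          case True
          then have i1: "i = 2 * (m - 1) + 1" using Suc m by linarith
          have "coeff (E (m - 1) 0 * (P (Suc 1) r - P (Suc 1) 0)) (2 * (m - 1) + 1) =
             coeff (E (m - 1) 0) (2 * (m - 1)) * coeff (P (Suc 1) r - P (Suc 1) 0) 1"
            by (rule coeff_mult_top) (use E_deg[of "m - 1" 0] top in simp_all)
          also have "coeff (P (Suc 1) r - P (Suc 1) 0) 1 = 2 * ?h"
            using P2[of r] by (simp add: numeral_2_eq_2)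
          finally show ?thesis using E_lead[of "m - 1" 0] True by (simp add: i1)
        next
          case False
          have "coeff ((P (Suc 1) r - P (Suc 1) 0) * E (m - 1) 0) i = 0"
          proof (rule coeff_mult_eq_0_beyond)
            show "coeff (P (Suc 1) r - P (Suc 1) 0) i' = 0" if "i' \<ge> 2" for i'
              using top[of i'] that by simp
            show "degree (E (m - 1) 0) \<le> 2 * (m - 1)" by (rule E_deg) simp
            show "2 + 2 * (m - 1) \<le> i" using i Suc False m by linarith
          qed
          then show ?thesis using False by (simp add: mult.commute)
        qed
        finally show ?thesis .
      qed
      have "coeff (E' r - E' 0) i = (\<Sum>k\<le>m. (-1) ^ k * D k) / real (Suc m)"
        unfolding D_def coeff_diff coeff_E'
        by (simp add: right_diff_distrib sum_subtractf diff_divide_distrib del: of_nat_Suc)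
      also have "(\<Sum>k\<le>m. (-1) ^ k * D k) = D 0 - (if m \<ge> 1 then D 1 else 0)"
      proof (cases "m \<ge> 1")
        case True
        have "(\<Sum>k\<le>m. (-1) ^ k * D k) = (\<Sum>k\<in>{0, 1}. (-1) ^ k * D k)"
          by (rule sum.mono_neutral_right) (use True D_rest in auto)
        then show ?thesis using True by simp
      next
        case False
        then have "m = 0" by simp
        then show ?thesis by simp
      qed
      also have "\<dots> = (if i + 3 = 2 * q then - (real (Suc m) * (?h / fact (m - 1))) else 0)"
      proof (cases "i + 3 = 2 * q")
        case True
        then have m1: "m \<ge> 1" using Suc by linarith
        show ?thesis
        proof (cases "m = 1")
          case True
          then show ?thesis using D0 D1 \<open>i + 3 = 2 * q\<close> by simp
        next
          case False
          then have "m = Suc (Suc (m - 2))" using m1 by linarith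
          then obtain p where p: "m = Suc (Suc p)" by blast
          \<comment> \<open>with \<open>m = p + 2\<close>: \<open>1 / p! + 2 / (p + 1)! = (p + 3) / (p + 1)!\<close>\<close>
          define x where "x = ?h / fact (Suc p)"
          have "D 0 = - (?h / fact p)" using D0 True p by simp
          moreover have "?h / fact p = real (Suc p) * x" by (simp add: x_def)
          moreover have "D 1 = 2 * x" using D1 True p by (simp add: x_def)
          moreover have "?h / fact (m - 1) = x" by (simp add: x_def p)
          ultimately show ?thesis using True by (simp add: p algebra_simps)
        qed
      next
        case False
        then show ?thesis using D0 D1 by simp
      qed
      finally show ?thesis by (simp add: Suc del: of_nat_Suc)
    qed
    show ?thesis
      by (intro exI[of _ E'] conjI allI impI eval deg lead diff)
  qed
qed

section \<open>Uniqueness of the expansion and the third coefficient\<close>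

lemma is_period_add_mult:
  assumes "is_period f p"
  shows "f (n + k * p) = f n"
proof (induction k)
  case (Suc k)
  have "f (n + Suc k * p) = f (n + k * p + p)" by (simp add: algebra_simps)
  then show ?case using assms Suc by (simp add: is_period_def)
qed simp

text \<open>Along \<open>n + k M\<close>, with \<open>M\<close> a common period of all coefficients, both expansions are polynomials in
  \<open>n + k M\<close> with fixed coefficients, and they agree at infinitely many points.\<close>

lemma quasipoly_expansion_unique:
  assumes \<gamma>: "quasipoly_expansion f D \<gamma>" and \<delta>: "quasipoly_expansion f D \<delta>" and "i \<le> D"
  shows "\<gamma> i n = \<delta> i n"
proof -
  obtain p where p: "\<And>i. i \<le> D \<Longrightarrow> is_period (\<gamma> i) (p i)"
    using \<gamma> unfolding quasipoly_expansion_def by metis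
  obtain q where q: "\<And>i. i \<le> D \<Longrightarrow> is_period (\<delta> i) (q i)"
    using \<delta> unfolding quasipoly_expansion_def by metis
  define M where "M = (\<Prod>i\<le>D. p i * q i)"
  have M: "M > 0" unfolding M_def using p q by (intro prod_pos) (auto simp: is_period_def)
  have shift: "\<gamma> i (n + k * M) = \<gamma> i n" "\<delta> i (n + k * M) = \<delta> i n" if "i \<le> D" for i k
  proof -
    have "p i * q i dvd M" unfolding M_def using that by (intro dvd_prodI) auto
    then obtain s where s: "M = p i * q i * s" by blast
    show "\<gamma> i (n + k * M) = \<gamma> i n"
      using is_period_add_mult[OF p[OF that], of n "k * q i * s"] by (simp add: s mult_ac)
    show "\<delta> i (n + k * M) = \<delta> i n"
      using is_period_add_mult[OF q[OF that], of n "k * p i * s"] by (simp add: s mult_ac)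
  qed
  define g where "g = (\<Sum>i\<le>D. monom (\<gamma> i n - \<delta> i n) (D - i))"
  have "poly g (real (n + k * M)) = 0" if "k \<ge> 1" for k
  proof -
    have "n + k * M \<ge> 1" using M that by (simp add: Suc_leI)
    then have "(\<Sum>i=0..D. \<gamma> i (n + k * M) * real (n + k * M) ^ (D - i)) =
        (\<Sum>i=0..D. \<delta> i (n + k * M) * real (n + k * M) ^ (D - i))"
      using \<gamma> \<delta> unfolding quasipoly_expansion_def by auto
    then have "(\<Sum>i\<le>D. \<gamma> i n * real (n + k * M) ^ (D - i)) = (\<Sum>i\<le>D. \<delta> i n * real (n + k * M) ^ (D - i))"
      by (simp add: shift atLeast0AtMost del: of_nat_add)
    then show ?thesis
      by (simp add: g_def poly_sum poly_monom left_diff_distrib sum_subtractf del: of_nat_add)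
  qed
  then have "(\<lambda>k. real (n + k * M)) ` {1..} \<subseteq> {x. poly g x = 0}" by auto
  moreover have "infinite ((\<lambda>k. real (n + k * M)) ` {1..})"
    using M by (subst finite_image_iff) (auto simp: inj_on_def infinite_Ici)
  ultimately have "g = 0" using poly_roots_finite finite_subset by blast
  then have "0 = coeff g (D - i)" by simp
  also have "\<dots> = (\<Sum>j\<le>D. if j = i then \<gamma> i n - \<delta> i n else 0)"
    unfolding g_def coeff_sum by (intro sum.cong refl) (use \<open>i \<le> D\<close> in auto)
  also have "\<dots> = \<gamma> i n - \<delta> i n" using \<open>i \<le> D\<close> by simp
  finally show ?thesis by simp
qed

lemma quasipoly_expansion_of_polys:
  assumes "d > 0" and "\<And>n. f n = poly (E (n mod d)) (real n)" and deg: "\<And>r. degree (E r) \<le> D"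
  shows "quasipoly_expansion f D (\<lambda>i n. coeff (E (n mod d)) (D - i))"
  unfolding quasipoly_expansion_def
proof (intro conjI allI impI)
  fix i
  show "\<exists>p. is_period (\<lambda>n. coeff (E (n mod d)) (D - i)) p"
    using assms(1) by (intro exI[of _ d]) (simp add: is_period_def)
next
  fix n :: nat
  let ?p = "E (n mod d)"
  have "f n = (\<Sum>i\<le>D. coeff ?p i * real n ^ i)"
    unfolding assms(2) poly_altdef using deg
    by (intro sum.mono_neutral_left) (auto simp: coeff_eq_0)
  also have "\<dots> = (\<Sum>i=0..D. coeff ?p (D - i) * real n ^ (D - i))"
    by (subst sum.atLeastAtMost_rev) (simp add: atLeast0AtMost sum.atLeastAtMost_rev[of _ 0 D])
  finally show "f n = (\<Sum>i=0..D. coeff ?p (D - i) * real n ^ (D - i))" .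
qed

lemma fractional_defect_eq_0_iff:
  assumes "r < d" "c < d"
  shows "fractional_defect c d r = 0 \<longleftrightarrow> r = 0"
  using assms by (auto simp: fractional_defect_def)

theorem proposition6p2:
  fixes c d :: int and q :: nat
  assumes "coprime c d" and "0 \<le> c" and "c \<le> d" and "d > 0" and "q \<ge> 2"
  shows "(\<exists>\<gamma>. quasipoly_expansion (\<lambda>n. real (num_placements {(c, d)} q n)) (2 * q) \<gamma>) \<and>
    (\<forall>\<gamma>. quasipoly_expansion (\<lambda>n. real (num_placements {(c, d)} q n)) (2 * q) \<gamma> \<longrightarrow>
       smallest_period (\<gamma> 3) (nat d) \<and>
       (\<exists>C. \<forall>n. \<gamma> 3 n = C +
          (let nbar = real_of_int (int n mod d) in
           - (1 / fact (q - 2)) *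
             (nbar * (real_of_int d - nbar) * (real_of_int d - real_of_int c) / (2 * (real_of_int d)\<^sup>2)))))"
proof -
  define c' d' where "c' = nat c" and "d' = nat d"
  have c: "c = int c'" and d: "d = int d'" using assms by (simp_all add: c'_def d'_def)
  have cd: "coprime c' d'" "d' > 0" "c' \<le> d'" using assms by (simp_all add: c d)
  let ?f = "\<lambda>n. real (num_placements {(c, d)} q n)"
  have f: "?f n = real (card (partial_transversals (line_label (int c') (int d')) (board n) q))" for n
    using assms by (simp add: num_placements_def nonattacking_placements_eq_partial_transversals c d)
  obtain E where eval: "\<And>n. ?f n = poly (E (n mod d')) (real n)"
    and deg: "\<And>r. degree (E r) \<le> 2 * q"
    and diff: "\<And>r i. i + 3 \<ge> 2 * q \<Longrightarrow> coeff (E r - E 0) i =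
        (if i + 3 = 2 * q then - (fractional_defect c' d' r / fact (q - 2)) else 0)"
    using ex_placement_polys[OF cd, of q] unfolding f by blast
  let ?\<gamma> = "\<lambda>i n. coeff (E (n mod d')) (2 * q - i)"
  have expansion: "quasipoly_expansion ?f (2 * q) ?\<gamma>"
    by (rule quasipoly_expansion_of_polys[OF cd(2) eval deg])
  show ?thesis
  proof (intro conjI allI impI)
    show "\<exists>\<gamma>. quasipoly_expansion ?f (2 * q) \<gamma>" using expansion by blast
  next
    fix \<gamma> assume \<gamma>: "quasipoly_expansion ?f (2 * q) \<gamma>"
    define C where "C = coeff (E 0) (2 * q - 3)"
    have \<gamma>3: "\<gamma> 3 n = C - fractional_defect c' d' (n mod d') / fact (q - 2)" for n
    proof -
      have "\<gamma> 3 n = ?\<gamma> 3 n"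
        using assms(5) by (intro quasipoly_expansion_unique[OF \<gamma> expansion]) simp
      then show ?thesis
        using diff[of "2 * q - 3" "n mod d'"] assms(5) by (simp add: C_def)
    qed
    show "smallest_period (\<gamma> 3) (nat d)"
      unfolding smallest_period_def
    proof (intro conjI allI impI)
      show "is_period (\<gamma> 3) (nat d)" using cd by (simp add: is_period_def \<gamma>3 d)
      fix p assume p: "is_period (\<gamma> 3) p"
      then have p0: "p > 0" by (simp add: is_period_def)
      show "nat d \<le> p"
      proof (cases "c' = d'")
        case True
        then show ?thesis using cd p0 by (simp add: d)
      next
        case False
        have "\<gamma> 3 (0 + p) = \<gamma> 3 0" using p by (simp only: is_period_def)
        then have "fractional_defect c' d' (p mod d') = 0"
          by (simp add: \<gamma>3 fractional_defect_def)
        then have "p mod d' = 0" using fractional_defect_eq_0_iff[of "p mod d'" d' c'] cd False by simp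
        then show ?thesis using p0 by (auto simp: d dest: dvd_imp_le)
      qed
    qed
    show "\<exists>C. \<forall>n. \<gamma> 3 n = C +
          (let nbar = real_of_int (int n mod d) in
           - (1 / fact (q - 2)) *
             (nbar * (real_of_int d - nbar) * (real_of_int d - real_of_int c) / (2 * (real_of_int d)\<^sup>2)))"
    proof (intro exI[of _ C] allI)
      fix n
      have "real_of_int (int n mod d) = real (n mod d')" by (simp add: d flip: zmod_int)
      then show "\<gamma> 3 n = C +
          (let nbar = real_of_int (int n mod d) in
           - (1 / fact (q - 2)) *
             (nbar * (real_of_int d - nbar) * (real_of_int d - real_of_int c) / (2 * (real_of_int d)\<^sup>2)))"
        by (simp add: Let_def \<gamma>3 fractional_defect_def c d)
    qed
  qed
qed

end
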